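(* Let $L=\{(a,b)\in[0,1]\times[0,1] \mid a+b\le 1\}$, let $p_1,p_2:L\to[0,1]$ be the projections $p_1(a,b)=a$ and $p_2(a,b)=b$, and let $\Delta_1=\{\bar 0,\,p_1,\,\bar 1\}$ and $\Delta_2=\{\bar 0,\,\bar 1-p_2,\,\bar 1\}$. Then the fuzzy bitopological space $(L,\Delta_1,\Delta_2)$ is a Sierpinski object in $\mathbf{BFTS}$; that is, for every fuzzy bitopological space $(X,\tau_1,\tau_2)$, the family of all bicontinuous maps $(X,\tau_1,\tau_2)\to(L,\Delta_1,\Delta_2)$ is initial.
   Context: Let $I=[0,1]$. For a set $X$, $\bar 0,\bar 1:X\to I$ denote the constant maps with values $0$ and $1$. A fuzzy topology on $X$ is a family $\tau\subseteq I^X$ closed under arbitrary (pointwise) suprema and finite (pointwise) infima, including the empty ones, so that $\bar 0,\bar 1\in\tau$. A fuzzy bitopological space is a triple $(X,\tau_1,\tau_2)$ with $X$ a set and $\tau_1,\tau_2$ fuzzy topologies on $X$. For a map $f:X\to Y$ and $\nu\in I^Y$, put $f^{\leftarrow}(\nu)=\nu\circ f$. A map $f:(X,\tau_1,\tau_2)\to(Y,\delta_1,\delta_2)$ is bicontinuous if $f^{\leftarrow}(\nu)\in\tau_i$ for every $\nu\in\delta_i$, $i=1,2$. $\mathbf{BFTS}$ is the category of all fuzzy bitopological spaces and bicontinuous maps. A family $\mathscr F$ of bicontinuous maps $f:(X,\tau_1,\tau_2)\to(Y_f,\delta_f,\delta_f')$ is initial if $\tau_1$ is the fuzzy topology on $X$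 with subbase $\{f^{\leftarrow}(\mu)\mid f\in\mathscr F,\ \mu\in\delta_f\}$ and $\tau_2$ is the fuzzy topology on $X$ with subbase $\{f^{\leftarrow}(\mu')\mid f\in\mathscr F,\ \mu'\in\delta_f'\}$. Equivalently: for every fuzzy bitopological space $(Z,\sigma_1,\sigma_2)$ and every map $g:Z\to X$, if $f\circ g$ is bicontinuous for all $f\in\mathscr F$, then $g$ is bicontinuous. (The fuzzy topology with subbase $\mathscr S$ is the smallest fuzzy topology containing $\mathscr S$.) *)

theory Defs
  imports Complex_Main "HOL-Library.FuncSet"
begin

text \<open>Spaces have explicit carrier sets, so the empty space is included. Maps out of a carrier
  \<open>X\<close>, fuzzy sets among them, are extensional functions (\<open>undefined\<close> outside \<open>X\<close>), so that
  equality of maps on \<open>X\<close> is equality in HOL.\<close>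

definition fuzzy_sets :: "'a set \<Rightarrow> ('a \<Rightarrow> real) set" where
  "fuzzy_sets X = X \<rightarrow>\<^sub>E {0..1}"

definition fuzzy_const :: "'a set \<Rightarrow> real \<Rightarrow> 'a \<Rightarrow> real" where
  "fuzzy_const X c = (\<lambda>x\<in>X. c)"

text \<open>Suprema and infima are those of the complete lattice \<open>[0,1]\<close>. Inserting the bounds 0 and 1
  only matters for the empty family, where it gives the constants 0 and 1.\<close>

definition fuzzy_Sup :: "'a set \<Rightarrow> ('a \<Rightarrow> real) set \<Rightarrow> 'a \<Rightarrow> real" where
  "fuzzy_Sup X A = (\<lambda>x\<in>X. Sup (insert 0 ((\<lambda>\<mu>. \<mu> x) ` A)))"

definition fuzzy_Inf :: "'a set \<Rightarrow> ('a \<Rightarrow> real) set \<Rightarrow> 'a \<Rightarrow> real" where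
  "fuzzy_Inf X A = (\<lambda>x\<in>X. Inf (insert 1 ((\<lambda>\<mu>. \<mu> x) ` A)))"

definition fuzzy_topology :: "'a set \<Rightarrow> ('a \<Rightarrow> real) set \<Rightarrow> bool" where
  "fuzzy_topology X \<tau> \<longleftrightarrow>
     \<tau> \<subseteq> fuzzy_sets X \<and>
     (\<forall>A. A \<subseteq> \<tau> \<longrightarrow> fuzzy_Sup X A \<in> \<tau>) \<and>
     (\<forall>A. A \<subseteq> \<tau> \<and> finite A \<longrightarrow> fuzzy_Inf X A \<in> \<tau>)"

definition fuzzy_bitop_space ::
  "'a set \<Rightarrow> ('a \<Rightarrow> real) set \<Rightarrow> ('a \<Rightarrow> real) set \<Rightarrow> bool" where
  "fuzzy_bitop_space X \<tau>\<^sub>1 \<tau>\<^sub>2 \<longleftrightarrow> fuzzy_topology X \<tau>\<^sub>1 \<and> fuzzy_topology X \<tau>\<^sub>2"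

text \<open>The preimage of a fuzzy set \<open>\<nu>\<close> under \<open>f\<close> is \<open>compose X \<nu> f\<close>, the composite \<open>\<nu> \<circ> f\<close>
  restricted to \<open>X\<close>.\<close>

definition bicontinuous_maps ::
  "'a set \<Rightarrow> ('a \<Rightarrow> real) set \<Rightarrow> ('a \<Rightarrow> real) set \<Rightarrow>
   'b set \<Rightarrow> ('b \<Rightarrow> real) set \<Rightarrow> ('b \<Rightarrow> real) set \<Rightarrow> ('a \<Rightarrow> 'b) set" where
  "bicontinuous_maps X \<tau>\<^sub>1 \<tau>\<^sub>2 Y \<delta>\<^sub>1 \<delta>\<^sub>2 =
     {f \<in> X \<rightarrow>\<^sub>E Y. (\<forall>\<nu>\<in>\<delta>\<^sub>1. compose X \<nu> f \<in> \<tau>\<^sub>1) \<and> (\<forall>\<nu>\<in>\<delta>\<^sub>2. compose X \<nu> f \<in> \<tau>\<^sub>2)}"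

definition fuzzy_topology_with_subbase ::
  "'a set \<Rightarrow> ('a \<Rightarrow> real) set \<Rightarrow> ('a \<Rightarrow> real) set \<Rightarrow> bool" where
  "fuzzy_topology_with_subbase X \<tau> S \<longleftrightarrow>
     fuzzy_topology X \<tau> \<and> S \<subseteq> \<tau> \<and> (\<forall>\<sigma>. fuzzy_topology X \<sigma> \<and> S \<subseteq> \<sigma> \<longrightarrow> \<tau> \<subseteq> \<sigma>)"

text \<open>A family \<open>F\<close> of bicontinuous maps out of \<open>(X, \<tau>\<^sub>1, \<tau>\<^sub>2)\<close>, where \<open>f \<in> F\<close> has codomain
  \<open>(Y f, \<delta> f, \<delta>' f)\<close>.\<close>

definition initial_family ::
  "'a set \<Rightarrow> ('a \<Rightarrow> real) set \<Rightarrow> ('a \<Rightarrow> real) set \<Rightarrow> ('a \<Rightarrow> 'b) set \<Rightarrow>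
   (('a \<Rightarrow> 'b) \<Rightarrow> 'b set) \<Rightarrow> (('a \<Rightarrow> 'b) \<Rightarrow> ('b \<Rightarrow> real) set) \<Rightarrow>
   (('a \<Rightarrow> 'b) \<Rightarrow> ('b \<Rightarrow> real) set) \<Rightarrow> bool" where
  "initial_family X \<tau>\<^sub>1 \<tau>\<^sub>2 F Y \<delta> \<delta>' \<longleftrightarrow>
     fuzzy_bitop_space X \<tau>\<^sub>1 \<tau>\<^sub>2 \<and>
     (\<forall>f\<in>F. fuzzy_bitop_space (Y f) (\<delta> f) (\<delta>' f) \<and>
        f \<in> bicontinuous_maps X \<tau>\<^sub>1 \<tau>\<^sub>2 (Y f) (\<delta> f) (\<delta>' f)) \<and>
     fuzzy_topology_with_subbase X \<tau>\<^sub>1 {compose X \<mu> f | f \<mu>. f \<in> F \<and> \<mu> \<in> \<delta> f} \<and>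
     fuzzy_topology_with_subbase X \<tau>\<^sub>2 {compose X \<mu> f | f \<mu>. f \<in> F \<and> \<mu> \<in> \<delta>' f}"

text \<open>HOL cannot quantify over types inside a formula, so the type of the points of the test
  spaces \<open>X\<close> is a parameter. A theorem with a free type variable there covers all of them.\<close>

definition sierpinski_object ::
  "'a itself \<Rightarrow> 'b set \<Rightarrow> ('b \<Rightarrow> real) set \<Rightarrow> ('b \<Rightarrow> real) set \<Rightarrow> bool" where
  "sierpinski_object _ S \<Delta>\<^sub>1 \<Delta>\<^sub>2 \<longleftrightarrow>
     fuzzy_bitop_space S \<Delta>\<^sub>1 \<Delta>\<^sub>2 \<and>
     (\<forall>(X :: 'a set) \<tau>\<^sub>1 \<tau>\<^sub>2. fuzzy_bitop_space X \<tau>\<^sub>1 \<tau>\<^sub>2 \<longrightarrow>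
        initial_family X \<tau>\<^sub>1 \<tau>\<^sub>2 (bicontinuous_maps X \<tau>\<^sub>1 \<tau>\<^sub>2 S \<Delta>\<^sub>1 \<Delta>\<^sub>2)
          (\<lambda>_. S) (\<lambda>_. \<Delta>\<^sub>1) (\<lambda>_. \<Delta>\<^sub>2))"

definition sier_L :: "(real \<times> real) set" where
  "sier_L = {(a, b) \<in> {0..1} \<times> {0..1}. a + b \<le> 1}"

definition sier_p1 :: "real \<times> real \<Rightarrow> real" where
  "sier_p1 = restrict fst sier_L"

definition sier_p2 :: "real \<times> real \<Rightarrow> real" where
  "sier_p2 = restrict snd sier_L"

definition sier_Delta1 :: "(real \<times> real \<Rightarrow> real) set" where
  "sier_Delta1 = {fuzzy_const sier_L 0, sier_p1, fuzzy_const sier_L 1}"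

definition sier_Delta2 :: "(real \<times> real \<Rightarrow> real) set" where
  "sier_Delta2 = {fuzzy_const sier_L 0, (\<lambda>z\<in>sier_L. 1 - sier_p2 z), fuzzy_const sier_L 1}"

end

theory Submission
  imports Defs
begin

text \<open>An open fuzzy set \<open>\<mu>\<close> of the first topology is the preimage of \<open>p\<^sub>1\<close> under \<open>x \<mapsto> (\<mu> x, 0)\<close>, and an
  open fuzzy set \<open>\<mu>\<close> of the second is the preimage of \<open>1 - p\<^sub>2\<close> under \<open>x \<mapsto> (0, 1 - \<mu> x)\<close>. Each of
  these maps is bicontinuous because its other coordinate pulls back to the constant 1 or 0.
  Hence both subbases are the whole topologies.\<close>

text \<open>A supremum that is attained is a maximum, so a pointwise upper bound taken from the
  family is the supremum. Admitting \<open>fuzzy_const X 0\<close> as a candidate covers the empty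
  family.\<close>

lemma fuzzy_Sup_eqI:
  assumes "\<nu> \<in> insert (fuzzy_const X 0) A" "\<nu> \<in> fuzzy_sets X"
    and "\<And>\<mu> x. \<mu> \<in> A \<Longrightarrow> x \<in> X \<Longrightarrow> \<mu> x \<le> \<nu> x"
  shows "fuzzy_Sup X A = \<nu>"
proof
  fix x
  show "fuzzy_Sup X A x = \<nu> x"
  proof (cases "x \<in> X")
    case True
    \<comment> \<open>This bound handles the extra element 0 that \<open>fuzzy_Sup\<close> inserts:
      \<open>\<nu> x\<close> must dominate it as well.\<close>
    then have "0 \<le> \<nu> x" using assms(2) by (auto simp: fuzzy_sets_def dest: PiE_mem)
    then have "Sup (insert 0 ((\<lambda>\<mu>. \<mu> x) ` A)) = \<nu> x"
      using assms True by (intro cSup_eq_maximum) (auto simp: fuzzy_const_def)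
    then show ?thesis using True by (simp add: fuzzy_Sup_def)
  next
    case False
    then show ?thesis using assms(2) by (auto simp: fuzzy_Sup_def fuzzy_sets_def dest: PiE_arb)
  qed
qed

lemma fuzzy_Inf_eqI:
  assumes "\<nu> \<in> insert (fuzzy_const X 1) A" "\<nu> \<in> fuzzy_sets X"
    and "\<And>\<mu> x. \<mu> \<in> A \<Longrightarrow> x \<in> X \<Longrightarrow> \<nu> x \<le> \<mu> x"
  shows "fuzzy_Inf X A = \<nu>"
proof
  fix x
  show "fuzzy_Inf X A x = \<nu> x"
  proof (cases "x \<in> X")
    case True
    then have "\<nu> x \<le> 1" using assms(2) by (auto simp: fuzzy_sets_def dest: PiE_mem)
    then have "Inf (insert 1 ((\<lambda>\<mu>. \<mu> x) ` A)) = \<nu> x"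
      using assms True by (intro cInf_eq_minimum) (auto simp: fuzzy_const_def)
    then show ?thesis using True by (simp add: fuzzy_Inf_def)
  next
    case False
    then show ?thesis using assms(2) by (auto simp: fuzzy_Inf_def fuzzy_sets_def dest: PiE_arb)
  qed
qed

lemma fuzzy_const_in_fuzzy_sets: "0 \<le> c \<Longrightarrow> c \<le> 1 \<Longrightarrow> fuzzy_const X c \<in> fuzzy_sets X"
  by (auto simp: fuzzy_const_def fuzzy_sets_def)

text \<open>The constants 0 and 1 are the supremum and the infimum of the empty family.\<close>

lemma fuzzy_topology_const:
  assumes "fuzzy_topology X \<tau>"
  shows "fuzzy_const X 0 \<in> \<tau>" "fuzzy_const X 1 \<in> \<tau>"
proof -
  have "fuzzy_Sup X {} \<in> \<tau>" "fuzzy_Inf X {} \<in> \<tau>"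
    using assms by (auto simp: fuzzy_topology_def)
  then show "fuzzy_const X 0 \<in> \<tau>" "fuzzy_const X 1 \<in> \<tau>"
    by (simp_all add: fuzzy_Sup_def fuzzy_Inf_def fuzzy_const_def)
qed

text \<open>The three fuzzy sets form a chain, with \<open>p\<close> between the two constants. Each
  nonempty subfamily therefore contains its supremum and infimum, and the empty one yields the
  constants 0 and 1.\<close>

lemma fuzzy_topology_three:
  assumes "p \<in> fuzzy_sets X"
  shows "fuzzy_topology X {fuzzy_const X 0, p, fuzzy_const X 1}" (is "fuzzy_topology X ?T")
proof -
  have T: "?T \<subseteq> fuzzy_sets X"
    using assms by (simp add: fuzzy_const_in_fuzzy_sets)
  have le: "fuzzy_const X 0 x \<le> \<mu> x" "\<mu> x \<le> fuzzy_const X 1 x" if "\<mu> \<in> ?T" "x \<in> X" for \<mu> x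
  proof -
    have "\<mu> x \<in> {0..1}" using T that by (metis PiE_mem fuzzy_sets_def subsetD)
    then show "fuzzy_const X 0 x \<le> \<mu> x" "\<mu> x \<le> fuzzy_const X 1 x"
      using that(2) by (simp_all add: fuzzy_const_def)
  qed
  have "fuzzy_Sup X A \<in> ?T" if A: "A \<subseteq> ?T" for A
  proof -
    \<comment> \<open>The cases follow the largest member of \<open>A\<close>: the constant 1, then
      \<open>p\<close>, then the constant 0. The last case includes the empty family.\<close>
    consider "fuzzy_const X 1 \<in> A" | "fuzzy_const X 1 \<notin> A" "p \<in> A" | "A \<subseteq> {fuzzy_const X 0}"
      using A by blast
    then obtain \<nu> where "\<nu> \<in> ?T" "\<nu> \<in> insert (fuzzy_const X 0) A"
      "\<And>\<mu> x. \<mu> \<in> A \<Longrightarrow> x \<in> X \<Longrightarrow> \<mu> x \<le> \<nu> x"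
    proof cases
      case 1
      then show ?thesis using A le(2) by (intro that[of "fuzzy_const X 1"]) blast+
    next
      case 2
      then have "A \<subseteq> {fuzzy_const X 0, p}" using A by blast
      then show ?thesis using 2 le(1)[of p] by (intro that[of p]) auto
    next
      case 3
      then show ?thesis by (intro that[of "fuzzy_const X 0"]) auto
    qed
    then show ?thesis using fuzzy_Sup_eqI T by (metis subsetD)
  qed
  moreover have "fuzzy_Inf X A \<in> ?T" if A: "A \<subseteq> ?T" for A
  proof -
    \<comment> \<open>Dually, the cases follow the smallest member, and the empty family falls under
      the constant 1.\<close>
    consider "fuzzy_const X 0 \<in> A" | "fuzzy_const X 0 \<notin> A" "p \<in> A" | "A \<subseteq> {fuzzy_const X 1}"
      using A by blast
    then obtain \<nu> where "\<nu> \<in> ?T" "\<nu> \<in> insert (fuzzy_const X 1) A"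
      "\<And>\<mu> x. \<mu> \<in> A \<Longrightarrow> x \<in> X \<Longrightarrow> \<nu> x \<le> \<mu> x"
    proof cases
      case 1
      then show ?thesis using A le(1) by (intro that[of "fuzzy_const X 0"]) blast+
    next
      case 2
      then have "A \<subseteq> {p, fuzzy_const X 1}" using A by blast
      then show ?thesis using 2 le(2)[of p] by (intro that[of p]) auto
    next
      case 3
      then show ?thesis by (intro that[of "fuzzy_const X 1"]) auto
    qed
    then show ?thesis using fuzzy_Inf_eqI T by (metis subsetD)
  qed
  ultimately show ?thesis using T by (auto simp: fuzzy_topology_def)
qed

lemma compose_fuzzy_const:
  "f \<in> X \<rightarrow>\<^sub>E Y \<Longrightarrow> compose X (fuzzy_const Y c) f = fuzzy_const X c"
  by (auto simp: compose_def fuzzy_const_def fun_eq_iff dest: PiE_mem)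

text \<open>Constants pull back to constants, which every fuzzy topology contains, so only the
  middle element of each of \<open>sier_Delta1\<close> and \<open>sier_Delta2\<close> has to be
  tested.\<close>

lemma bicontinuous_maps_sierI:
  assumes "fuzzy_bitop_space X \<tau>\<^sub>1 \<tau>\<^sub>2" "f \<in> X \<rightarrow>\<^sub>E sier_L"
    and "compose X sier_p1 f \<in> \<tau>\<^sub>1" "compose X (\<lambda>z\<in>sier_L. 1 - sier_p2 z) f \<in> \<tau>\<^sub>2"
  shows "f \<in> bicontinuous_maps X \<tau>\<^sub>1 \<tau>\<^sub>2 sier_L sier_Delta1 sier_Delta2"
  using assms
  by (simp add: bicontinuous_maps_def sier_Delta1_def sier_Delta2_def compose_fuzzy_const
      fuzzy_bitop_space_def fuzzy_topology_const)

lemma sier_open1_preimage: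
  assumes \<tau>: "fuzzy_bitop_space X \<tau>\<^sub>1 \<tau>\<^sub>2" and \<mu>: "\<mu> \<in> \<tau>\<^sub>1"
  obtains f where "f \<in> bicontinuous_maps X \<tau>\<^sub>1 \<tau>\<^sub>2 sier_L sier_Delta1 sier_Delta2"
    and "\<mu> = compose X sier_p1 f"
proof -
  define f where "f = (\<lambda>x\<in>X. (\<mu> x, 0 :: real))"
  have \<mu>_PiE: "\<mu> \<in> X \<rightarrow>\<^sub>E {0..1}"
    using \<tau> \<mu> by (auto simp: fuzzy_bitop_space_def fuzzy_topology_def fuzzy_sets_def)
  \<comment> \<open>With second coordinate 0 the constraint a + b \<le> 1 reduces to
    \<open>\<mu> x \<le> 1\<close>. Landing in \<open>sier_L\<close> matters below because the
    projections are undefined elsewhere.\<close>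
  then have f_L: "f x \<in> sier_L" if "x \<in> X" for x
    using that PiE_mem[OF \<mu>_PiE that] by (simp add: f_def sier_L_def)
  have 1: "compose X sier_p1 f = \<mu>"
  proof
    fix x
    \<comment> \<open>Outside \<open>X\<close> both sides are \<open>undefined\<close>, since
      \<open>\<mu>\<close> is extensional.\<close>
    show "compose X sier_p1 f x = \<mu> x"
      using f_L[of x] PiE_arb[OF \<mu>_PiE, of x] by (auto simp: compose_def sier_p1_def f_def)
  qed
  have "compose X (\<lambda>z\<in>sier_L. 1 - sier_p2 z) f = fuzzy_const X 1"
  proof
    fix x
    show "compose X (\<lambda>z\<in>sier_L. 1 - sier_p2 z) f x = fuzzy_const X 1 x"
      using f_L[of x] by (auto simp: compose_def sier_p2_def f_def fuzzy_const_def)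
  qed
  then have "f \<in> bicontinuous_maps X \<tau>\<^sub>1 \<tau>\<^sub>2 sier_L sier_Delta1 sier_Delta2"
    using 1 \<tau> \<mu> f_L
    by (intro bicontinuous_maps_sierI)
      (auto simp: f_def fuzzy_bitop_space_def fuzzy_topology_const)
  then show thesis using 1 that by metis
qed

lemma sier_open2_preimage:
  assumes \<tau>: "fuzzy_bitop_space X \<tau>\<^sub>1 \<tau>\<^sub>2" and \<mu>: "\<mu> \<in> \<tau>\<^sub>2"
  obtains f where "f \<in> bicontinuous_maps X \<tau>\<^sub>1 \<tau>\<^sub>2 sier_L sier_Delta1 sier_Delta2"
    and "\<mu> = compose X (\<lambda>z\<in>sier_L. 1 - sier_p2 z) f"
proof -
  \<comment> \<open>The second coordinate stores the complement of \<open>\<mu>\<close> because the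
    open set of \<open>sier_Delta2\<close> complements it again.\<close>
  define f where "f = (\<lambda>x\<in>X. (0 :: real, 1 - \<mu> x))"
  have \<mu>_PiE: "\<mu> \<in> X \<rightarrow>\<^sub>E {0..1}"
    using \<tau> \<mu> by (auto simp: fuzzy_bitop_space_def fuzzy_topology_def fuzzy_sets_def)
  \<comment> \<open>Here a + b \<le> 1 amounts to \<open>0 \<le> \<mu> x\<close>, and b \<ge> 0 to
    \<open>\<mu> x \<le> 1\<close>.\<close>
  then have f_L: "f x \<in> sier_L" if "x \<in> X" for x
    using that PiE_mem[OF \<mu>_PiE that] by (simp add: f_def sier_L_def)
  have 1: "compose X (\<lambda>z\<in>sier_L. 1 - sier_p2 z) f = \<mu>"
  proof
    fix x
    show "compose X (\<lambda>z\<in>sier_L. 1 - sier_p2 z) f x = \<mu> x"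
      using f_L[of x] PiE_arb[OF \<mu>_PiE, of x] by (auto simp: compose_def sier_p2_def f_def)
  qed
  have "compose X sier_p1 f = fuzzy_const X 0"
  proof
    fix x
    show "compose X sier_p1 f x = fuzzy_const X 0 x"
      using f_L[of x] by (auto simp: compose_def sier_p1_def f_def fuzzy_const_def)
  qed
  then have "f \<in> bicontinuous_maps X \<tau>\<^sub>1 \<tau>\<^sub>2 sier_L sier_Delta1 sier_Delta2"
    using 1 \<tau> \<mu> f_L
    by (intro bicontinuous_maps_sierI)
      (auto simp: f_def fuzzy_bitop_space_def fuzzy_topology_const)
  then show thesis using 1 that by metis
qed

text \<open>A fuzzy topology is the smallest one containing itself. Keeping \<open>S\<close> and the
  equation separate lets the rule apply to a set of preimages, leaving its equality with
  \<open>\<tau>\<close> as a goal.\<close>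

lemma fuzzy_topology_with_subbase_self:
  "fuzzy_topology X \<tau> \<Longrightarrow> S = \<tau> \<Longrightarrow> fuzzy_topology_with_subbase X \<tau> S"
  by (auto simp: fuzzy_topology_with_subbase_def)

lemma fuzzy_bitop_space_sier: "fuzzy_bitop_space sier_L sier_Delta1 sier_Delta2"
  unfolding fuzzy_bitop_space_def sier_Delta1_def sier_Delta2_def
  by (intro conjI fuzzy_topology_three)
    (auto simp: fuzzy_sets_def sier_L_def sier_p1_def sier_p2_def)

theorem theorem3p1:
  "sierpinski_object TYPE('a) sier_L sier_Delta1 sier_Delta2"
  unfolding sierpinski_object_def
proof (intro conjI allI impI fuzzy_bitop_space_sier)
  fix X :: "'a set" and \<tau>\<^sub>1 \<tau>\<^sub>2
  assume \<tau>: "fuzzy_bitop_space X \<tau>\<^sub>1 \<tau>\<^sub>2"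
  let ?F = "bicontinuous_maps X \<tau>\<^sub>1 \<tau>\<^sub>2 sier_L sier_Delta1 sier_Delta2"
  have "{compose X \<mu> f | f \<mu>. f \<in> ?F \<and> \<mu> \<in> sier_Delta1} = \<tau>\<^sub>1" (is "?S1 = _")
  proof
    \<comment> \<open>This inclusion is the bicontinuity of the members of \<open>?F\<close>; the
      reverse one is where enough maps into \<open>sier_L\<close> must exist.\<close>
    show "?S1 \<subseteq> \<tau>\<^sub>1" by (auto simp: bicontinuous_maps_def)
    show "\<tau>\<^sub>1 \<subseteq> ?S1"
    proof
      fix \<mu> assume "\<mu> \<in> \<tau>\<^sub>1"
      then obtain f where "f \<in> ?F" "\<mu> = compose X sier_p1 f"
        using sier_open1_preimage[OF \<tau>] by blast
      moreover have "sier_p1 \<in> sier_Delta1" by (simp add: sier_Delta1_def)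
      ultimately show "\<mu> \<in> ?S1" by blast
    qed
  qed
  moreover have "{compose X \<mu> f | f \<mu>. f \<in> ?F \<and> \<mu> \<in> sier_Delta2} = \<tau>\<^sub>2" (is "?S2 = _")
  proof
    show "?S2 \<subseteq> \<tau>\<^sub>2" by (auto simp: bicontinuous_maps_def)
    show "\<tau>\<^sub>2 \<subseteq> ?S2"
    proof
      fix \<mu> assume "\<mu> \<in> \<tau>\<^sub>2"
      then obtain f where "f \<in> ?F" "\<mu> = compose X (\<lambda>z\<in>sier_L. 1 - sier_p2 z) f"
        using sier_open2_preimage[OF \<tau>] by blast
      moreover have "(\<lambda>z\<in>sier_L. 1 - sier_p2 z) \<in> sier_Delta2" by (simp add: sier_Delta2_def)
      ultimately show "\<mu> \<in> ?S2" by blast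
    qed
  qed
  ultimately show "initial_family X \<tau>\<^sub>1 \<tau>\<^sub>2 ?F (\<lambda>_. sier_L) (\<lambda>_. sier_Delta1) (\<lambda>_. sier_Delta2)"
    using \<tau> fuzzy_bitop_space_sier unfolding initial_family_def
    by (auto intro!: fuzzy_topology_with_subbase_self simp: fuzzy_bitop_space_def)
qed

end
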